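(* Let $(A,\cdot_A)$ be a commutative associative algebra over $\mathbb{K}$ and let $(A[[\hbar]],\cdot_\hbar)$ be a pre-Lie formal deformation of $A$, given by bilinear maps $\mu_n:A\times A\to A$ ($n\ge 0$) with $\mu_0=\cdot_A$. Define $$[x,y]_A=\mu_1(x,y)-\mu_1(y,x),\qquad \forall\, x,y\in A.$$ Then $(A,\cdot_A,[-,-]_A)$ is an $F$-manifold algebra.
   Context: All vector spaces are finite dimensional over an algebraically closed field $\mathbb{K}$ of characteristic $0$ (here $A$; the space $A[[\hbar]]$ of formal power series in $\hbar$ with coefficients in $A$ is a $\mathbb{K}[[\hbar]]$-module). A pre-Lie algebra is a module $\mathfrak{g}$ with a bilinear product $\ast$ such that $(x\ast y)\ast z-x\ast(y\ast z)=(y\ast x)\ast z-y\ast(x\ast z)$ for all $x,y,z$. A pre-Lie formal deformation of a commutative associative algebra $(A,\cdot_A)$ is a sequence of bilinear maps $\mu_k:A\times A\to A$, $k\ge 0$, with $\mu_0=\cdot_A$, such that the $\mathbb{K}[[\hbar]]$-bilinear product $\cdot_\hbar$ on $A[[\hbar]]$ determined by $x\cdot_\hbar y=\sum_{n=0}^\infty \hbar^n\mu_n(x,y)$ for $x,y\in A$ is a pre-Lie product. Equivalently, for all $k\ge 0$ and $x,y,z\in A$, $$\sum_{i+j=k}\big(\mu_i(\mu_j(x,y),z)-\mu_i(x,\mu_j(y,z))\big)=\sum_{i+j=k}\big(\mu_i(\mu_j(y,x),z)-\mu_i(y,\mu_j(x,z))\big).$$ An $F$-manifold algebra is a triple $(A,\cdot_A,[-,-]_A)$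 where $(A,\cdot_A)$ is a commutative associative algebra and $(A,[-,-]_A)$ is a Lie algebra such that for all $x,y,z,w\in A$ the Hertling-Manin relation $P_{x\cdot_A y}(z,w)=x\cdot_A P_y(z,w)+y\cdot_A P_x(z,w)$ holds, where $P_x(y,z)=[x,y\cdot_A z]_A-[x,y]_A\cdot_A z-y\cdot_A[x,z]_A$. *)

theory Defs
  imports "HOL-Computational_Algebra.Polynomial" "HOL-Computational_Algebra.Formal_Power_Series"
begin

text \<open>
  All algebras live on a module given by the library locale \<open>module\<close> (over a commutative ring),
  so that the same definitions serve for algebras over a field \<open>K\<close> and over \<open>K[[h]]\<close>.
  Algebras are not assumed to be unital.
\<close>

definition bilinear_over ::
  "('r::comm_ring_1 \<Rightarrow> 'a::ab_group_add \<Rightarrow> 'a) \<Rightarrow> ('a \<Rightarrow> 'a \<Rightarrow> 'a) \<Rightarrow> bool" where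
  "bilinear_over s p \<longleftrightarrow>
    (\<forall>x. module_hom s s (\<lambda>y. p x y)) \<and> (\<forall>y. module_hom s s (\<lambda>x. p x y))"

locale comm_assoc_algebra = module scale
  for scale :: "'r::comm_ring_1 \<Rightarrow> 'a::ab_group_add \<Rightarrow> 'a" +
  fixes mul :: "'a \<Rightarrow> 'a \<Rightarrow> 'a"
  assumes mul_bilinear: "bilinear_over scale mul"
    and mul_assoc: "mul (mul x y) z = mul x (mul y z)"
    and mul_commute: "mul x y = mul y x"

locale lie_algebra = module scale
  for scale :: "'r::comm_ring_1 \<Rightarrow> 'a::ab_group_add \<Rightarrow> 'a" +
  fixes br :: "'a \<Rightarrow> 'a \<Rightarrow> 'a"
  assumes br_bilinear: "bilinear_over scale br"
    and br_self: "br x x = 0"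
    and br_jacobi: "br x (br y z) + br y (br z x) + br z (br x y) = 0"

locale pre_lie_algebra = module scale
  for scale :: "'r::comm_ring_1 \<Rightarrow> 'a::ab_group_add \<Rightarrow> 'a" +
  fixes ast :: "'a \<Rightarrow> 'a \<Rightarrow> 'a"
  assumes ast_bilinear: "bilinear_over scale ast"
    and pre_lie: "ast (ast x y) z - ast x (ast y z) = ast (ast y x) z - ast y (ast x z)"

text \<open>The Leibniz defect \<open>P\<^sub>x(y,z) = [x, y z] - [x,y] z - y [x,z]\<close>.\<close>

definition leibniz_defect ::
  "('a \<Rightarrow> 'a \<Rightarrow> 'a) \<Rightarrow> ('a \<Rightarrow> 'a \<Rightarrow> 'a) \<Rightarrow> 'a \<Rightarrow> 'a \<Rightarrow> 'a \<Rightarrow> 'a::ab_group_add" where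
  "leibniz_defect mul br x y z = br x (mul y z) - mul (br x y) z - mul y (br x z)"

locale F_manifold_algebra = comm_assoc_algebra scale mul + lie_algebra scale br
  for scale :: "'r::comm_ring_1 \<Rightarrow> 'a::ab_group_add \<Rightarrow> 'a"
    and mul :: "'a \<Rightarrow> 'a \<Rightarrow> 'a"
    and br :: "'a \<Rightarrow> 'a \<Rightarrow> 'a" +
  assumes hertling_manin:
    "leibniz_defect mul br (mul x y) z w =
       mul x (leibniz_defect mul br y z w) + mul y (leibniz_defect mul br x z w)"

text \<open>
  \<open>A[[h]]\<close> is the type \<open>'a fps\<close>, of which only the additive structure is used.
  A scalar series acts by the Cauchy product.
\<close>

definition fps_scale ::
  "('r::comm_ring_1 \<Rightarrow> 'a::ab_group_add \<Rightarrow> 'a) \<Rightarrow> 'r fps \<Rightarrow> 'a fps \<Rightarrow> 'a fps" where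
  "fps_scale scale c f = Abs_fps (\<lambda>n. \<Sum>i=0..n. scale (fps_nth c i) (fps_nth f (n - i)))"

lemma module_fps_scale:
  assumes "module scale"
  shows "module (fps_scale scale)"
proof -
  interpret module scale by fact
  show ?thesis
  proof
    fix a b :: "'a fps" and x y :: "'b fps"
    show "fps_scale scale a (x + y) = fps_scale scale a x + fps_scale scale a y"
      by (simp add: fps_eq_iff fps_scale_def scale_right_distrib sum.distrib)
    show "fps_scale scale (a + b) x = fps_scale scale a x + fps_scale scale b x"
      by (simp add: fps_eq_iff fps_scale_def scale_left_distrib sum.distrib)
    show "fps_scale scale a (fps_scale scale b x) = fps_scale scale (a * b) x"
    proof (rule fps_ext)
      fix n
      have "(\<Sum>k=0..n. \<Sum>i=0..k. scale (fps_nth a i * fps_nth b (k - i)) (fps_nth x (n - k)))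
          = (\<Sum>i=0..n. \<Sum>j=0..n - i. scale (fps_nth a i * fps_nth b j) (fps_nth x (n - i - j)))"
        by (rule fps_mult_assoc_lemma[of "\<lambda>i j k. scale (fps_nth a i * fps_nth b j) (fps_nth x k)" n])
      then show "fps_nth (fps_scale scale a (fps_scale scale b x)) n
          = fps_nth (fps_scale scale (a * b) x) n"
        by (simp add: fps_scale_def scale_sum_right fps_mult_nth scale_sum_left)
    qed
    show "fps_scale scale 1 x = x"
    proof (rule fps_ext)
      fix n
      have "(\<Sum>i=0..n. scale (fps_nth (1::'a fps) i) (fps_nth x (n - i)))
          = (\<Sum>i=0..n. if i = 0 then fps_nth x n else 0)"
        by (rule sum.cong) auto
      then show "fps_nth (fps_scale scale 1 x) n = fps_nth x n"
        by (simp add: fps_scale_def)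
    qed
  qed
qed

text \<open>
  \<open>A\<close> embeds into \<open>A[[h]]\<close> by \<open>fps_const\<close>. The product \<open>hmul\<close> is a parameter: being
  \<open>K[[h]]\<close>-bilinear (part of \<open>pre_lie_algebra\<close>), it is determined by its values on \<open>A\<close>.
\<close>

locale pre_lie_formal_deformation = comm_assoc_algebra scale mul
  for scale :: "'k::field \<Rightarrow> 'a::ab_group_add \<Rightarrow> 'a"
    and mul :: "'a \<Rightarrow> 'a \<Rightarrow> 'a" +
  fixes \<mu> :: "nat \<Rightarrow> 'a \<Rightarrow> 'a \<Rightarrow> 'a"
    and hmul :: "'a fps \<Rightarrow> 'a fps \<Rightarrow> 'a fps"
  assumes \<mu>_bilinear: "bilinear_over scale (\<mu> n)"
    and \<mu>_0: "\<mu> 0 = mul"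
    and hmul_const: "hmul (fps_const x) (fps_const y) = Abs_fps (\<lambda>n. \<mu> n x y)"
    and hmul_pre_lie: "pre_lie_algebra (fps_scale scale) hmul"

end

theory Submission
  imports Defs
begin

text \<open>
  The coefficients of \<open>h\<close> and \<open>h\<^sup>2\<close> in the pre-Lie identity carry everything. In degree 1
  it says that the defect \<open>\<Phi>(x;y,z) = \<mu>\<^sub>1(x,yz) - \<mu>\<^sub>1(x,y)z - y\<mu>\<^sub>1(x,z)\<close>, which is
  symmetric in \<open>y,z\<close> anyway, is totally symmetric. The Hertling-Manin relation follows from this
  symmetry and from the cocycle identity
  \<open>\<Phi>(x;yz,w) + \<Phi>(x;y,z)w = \<Phi>(x;y,zw) + y\<Phi>(x;z,w)\<close>. In degree 2 the alternating sum over
  the arguments cancels the terms in \<open>\<mu>\<^sub>2\<close>, by commutativity of \<open>\<mu>\<^sub>0\<close>, and leaves the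
  Jacobi identity.
\<close>

lemma
  assumes "bilinear_over s p"
  shows bilinear_over_add_left: "p (x + y) z = p x z + p y z"
    and bilinear_over_add_right: "p x (y + z) = p x y + p x z"
    and bilinear_over_diff_left: "p (x - y) z = p x z - p y z"
    and bilinear_over_diff_right: "p x (y - z) = p x y - p x z"
    and bilinear_over_scale_left: "p (s c x) y = s c (p x y)"
    and bilinear_over_scale_right: "p x (s c y) = s c (p x y)"
proof -
  have l: "module_hom s s (\<lambda>x. p x y)" and r: "module_hom s s (p x)" for x y
    using assms by (auto simp: bilinear_over_def)
  show "p (x + y) z = p x z + p y z" "p (x - y) z = p x z - p y z" "p (s c x) y = s c (p x y)"
    using module_hom.add[OF l] module_hom.diff[OF l] module_hom.scale[OF l] by blast+
  show "p x (y + z) = p x y + p x z" "p x (y - z) = p x y - p x z" "p x (s c y) = s c (p x y)"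
    using module_hom.add[OF r] module_hom.diff[OF r] module_hom.scale[OF r] by blast+
qed

lemma bilinear_over_commutator:
  assumes "module s" and p: "bilinear_over s p"
  shows "bilinear_over s (\<lambda>x y. p x y - p y x)"
proof -
  interpret module s by fact
  show ?thesis
    unfolding bilinear_over_def
    by (intro conjI allI; unfold_locales)
      (simp_all add: bilinear_over_add_left[OF p] bilinear_over_add_right[OF p]
        bilinear_over_scale_left[OF p] bilinear_over_scale_right[OF p] scale_right_diff_distrib)
qed

lemma (in module) fps_scale_X_nth:
  "fps_nth (fps_scale scale fps_X f) n = (if n = 0 then 0 else fps_nth f (n - 1))"
proof (cases n)
  case 0
  then show ?thesis by (simp add: fps_scale_def)
next
  case (Suc m)
  have "(\<Sum>i=0..n. scale (fps_nth fps_X i) (fps_nth f (n - i)))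
      = (\<Sum>i=0..n. if i = 1 then fps_nth f (n - 1) else 0)"
    by (rule sum.cong) (auto simp: fps_X_def)
  then show ?thesis using Suc by (simp add: fps_scale_def)
qed

text \<open>Splitting off one factor h turns bilinearity over K[[h]] into a recursion on
  coefficients, so no infinite sum has to pass through \<open>hmul\<close>.\<close>

lemma (in module) fps_const_plus_scale_X:
  "fps_const (fps_nth f 0) + fps_scale scale fps_X (Abs_fps (\<lambda>n. fps_nth f (Suc n))) = f"
  by (auto simp: fps_eq_iff fps_scale_X_nth)

context comm_assoc_algebra
begin

lemma hertling_manin_commutator:
  assumes sym: "\<And>x y z. leibniz_defect mul m x y z = leibniz_defect mul m y x z"
  defines "br \<equiv> \<lambda>x y. m x y - m y x"
  shows "leibniz_defect mul br (mul x y) z w =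
    mul x (leibniz_defect mul br y z w) + mul y (leibniz_defect mul br x z w)"
proof -
  define \<Phi> where "\<Phi> = leibniz_defect mul m"
  have mul_left_commute: "mul a (mul b c) = mul b (mul a c)" for a b c
    by (metis mul_assoc mul_commute)
  note alg = mul_assoc mul_commute mul_left_commute
    bilinear_over_add_left[OF mul_bilinear] bilinear_over_add_right[OF mul_bilinear]
    bilinear_over_diff_left[OF mul_bilinear] bilinear_over_diff_right[OF mul_bilinear]
  have \<Phi>_swap: "\<Phi> a b c = \<Phi> b a c" for a b c
    using sym by (simp add: \<Phi>_def)
  have \<Phi>_right: "\<Phi> a b c = \<Phi> a c b" for a b c
    by (simp add: \<Phi>_def leibniz_defect_def alg)
  \<comment> \<open>Up to sign, \<open>\<Phi> a\<close> is the Hochschild coboundary of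
    \<open>m a\<close>, hence a 2-cocycle.\<close>
  have cocycle: "\<Phi> a (mul b c) d = \<Phi> a b (mul c d) + mul b (\<Phi> a c d) - mul (\<Phi> a b c) d"
    for a b c d
    by (simp add: \<Phi>_def leibniz_defect_def alg)
  \<comment> \<open>The terms of the defect of \<open>br\<close> in which \<open>x\<close>, \<open>y\<close> are second arguments of \<open>m\<close>
    regroup into values of \<open>\<Phi>\<close> with the roles of \<open>x,y\<close> and \<open>z,w\<close> exchanged.\<close>
  have "leibniz_defect mul br (mul x y) z w
      - mul x (leibniz_defect mul br y z w) - mul y (leibniz_defect mul br x z w)
    = (\<Phi> (mul x y) z w - mul x (\<Phi> y z w) - mul y (\<Phi> x z w))
      - (\<Phi> (mul z w) x y - mul w (\<Phi> z x y) - mul z (\<Phi> w x y))"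
    by (simp add: \<Phi>_def br_def leibniz_defect_def alg)
  \<comment> \<open>Symmetry moves the product from the first slot to the second, where the cocycle
    identity can split it.\<close>
  also have "\<Phi> (mul x y) z w = \<Phi> z x (mul y w) + mul x (\<Phi> z y w) - mul (\<Phi> z x y) w"
    using cocycle \<Phi>_swap by metis
  also have "\<Phi> (mul z w) x y = \<Phi> x z (mul w y) + mul z (\<Phi> x w y) - mul (\<Phi> x z w) y"
    using cocycle \<Phi>_swap by metis
  \<comment> \<open>The two values still containing a product agree and cancel.\<close>
  also have "\<Phi> z x (mul y w) = \<Phi> x z (mul w y)"
    using \<Phi>_swap mul_commute by metis
  also have "\<Phi> z y w = \<Phi> y z w"
    by (rule \<Phi>_swap)
  also have "\<Phi> x w y = \<Phi> w x y"
    by (rule \<Phi>_swap)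
  finally show ?thesis
    by (simp add: mul_commute algebra_simps)
qed

end

context pre_lie_formal_deformation
begin

lemma hmul_bilinear: "bilinear_over (fps_scale scale) hmul"
  using hmul_pre_lie by (rule pre_lie_algebra.ast_bilinear)

text \<open>With f = f_0 + h g, the constant f_0 gives the summand i = 0, and g gives the others one
  degree lower; the induction hypothesis is applied to g, so f must vary.\<close>

lemma hmul_const_right_nth:
  "fps_nth (hmul f (fps_const z)) k = (\<Sum>i\<le>k. \<mu> (k - i) (fps_nth f i) z)"
proof (induction k arbitrary: f)
  case (0 f)
  show ?case
    by (subst fps_const_plus_scale_X[of f, symmetric])
      (simp add: bilinear_over_add_left[OF hmul_bilinear] bilinear_over_scale_left[OF hmul_bilinear]
        hmul_const fps_scale_X_nth)
next
  case (Suc k f)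
  show ?case
    by (subst fps_const_plus_scale_X[of f, symmetric], subst sum.atMost_Suc_shift)
      (simp add: bilinear_over_add_left[OF hmul_bilinear] bilinear_over_scale_left[OF hmul_bilinear]
        hmul_const fps_scale_X_nth Suc.IH)
qed

lemma hmul_const_left_nth:
  "fps_nth (hmul (fps_const x) f) k = (\<Sum>i\<le>k. \<mu> (k - i) x (fps_nth f i))"
proof (induction k arbitrary: f)
  case (0 f)
  show ?case
    by (subst fps_const_plus_scale_X[of f, symmetric])
      (simp add: bilinear_over_add_right[OF hmul_bilinear] bilinear_over_scale_right[OF hmul_bilinear]
        hmul_const fps_scale_X_nth)
next
  case (Suc k f)
  show ?case
    by (subst fps_const_plus_scale_X[of f, symmetric], subst sum.atMost_Suc_shift)
      (simp add: bilinear_over_add_right[OF hmul_bilinear] bilinear_over_scale_right[OF hmul_bilinear]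
        hmul_const fps_scale_X_nth Suc.IH)
qed

lemma pre_lie_coefficient:
  "(\<Sum>i\<le>k. \<mu> (k - i) (\<mu> i x y) z - \<mu> (k - i) x (\<mu> i y z)) =
   (\<Sum>i\<le>k. \<mu> (k - i) (\<mu> i y x) z - \<mu> (k - i) y (\<mu> i x z))"
  using arg_cong[where f = "\<lambda>f. fps_nth f k",
      OF pre_lie_algebra.pre_lie[OF hmul_pre_lie, of "fps_const x" "fps_const y" "fps_const z"]]
  by (simp add: hmul_const hmul_const_left_nth hmul_const_right_nth sum_subtractf)

text \<open>In degree 1 the terms \<open>\<mu> 1 (mul x y) z\<close> and
  \<open>\<mu> 1 (mul y x) z\<close> cancel; the rest rearranges to the claim.\<close>

lemma leibniz_defect_\<mu>_1_swap: "leibniz_defect mul (\<mu> 1) x y z = leibniz_defect mul (\<mu> 1) y x z"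
  using pre_lie_coefficient[of 1 x y z]
  by (simp add: leibniz_defect_def \<mu>_0 mul_commute[of x y] algebra_simps)

lemma jacobi_commutator_\<mu>_1:
  defines "br \<equiv> \<lambda>x y. \<mu> 1 x y - \<mu> 1 y x"
  shows "br x (br y z) + br y (br z x) + br z (br x y) = 0"
proof -
  \<comment> \<open>\<open>D\<close> measures how far \<open>\<mu> 1\<close> is from being pre-Lie
    itself: with L_x = \<open>\<mu> 1 x\<close>, it is L_[x,y] - [L_x, L_y] applied to z.\<close>
  define D where "D x y z = \<mu> 1 (br x y) z - \<mu> 1 x (\<mu> 1 y z) + \<mu> 1 y (\<mu> 1 x z)" for x y z
  have D: "D x y z = (\<mu> 2 x (mul y z) + mul x (\<mu> 2 y z)) - (\<mu> 2 y (mul x z) + mul y (\<mu> 2 x z))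
      - mul (\<mu> 2 x y) z + mul (\<mu> 2 y x) z" for x y z
    using pre_lie_coefficient[of 2 x y z]
    by (simp add: D_def br_def numeral_2_eq_2 \<mu>_0 mul_commute[of y x] algebra_simps
        bilinear_over_diff_left[OF \<mu>_bilinear])
  have "br x (br y z) + br y (br z x) + br z (br x y) = - (D x y z + D y z x + D z x y)"
    by (simp add: D_def br_def bilinear_over_diff_left[OF \<mu>_bilinear]
        bilinear_over_diff_right[OF \<mu>_bilinear])
  \<comment> \<open>Under the cyclic sum, \<open>\<mu> 2 x (mul y z)\<close> meets its negative from
    \<open>D z x y\<close>, and \<open>mul x (\<mu> 2 y z)\<close> its negative from
    \<open>D y z x\<close>.\<close>
  also have "D x y z + D y z x + D z x y = 0"
    by (simp add: D mul_commute algebra_simps)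
  finally show ?thesis by simp
qed

lemma F_manifold_algebra_commutator: "F_manifold_algebra scale mul (\<lambda>x y. \<mu> 1 x y - \<mu> 1 y x)"
proof unfold_locales
  show "bilinear_over scale (\<lambda>x y. \<mu> 1 x y - \<mu> 1 y x)"
    using module_axioms \<mu>_bilinear by (rule bilinear_over_commutator)
qed (simp_all only: diff_self jacobi_commutator_\<mu>_1
    hertling_manin_commutator[OF leibniz_defect_\<mu>_1_swap])

end

theorem theorem3p20:
  fixes scale :: "'k::{alg_closed_field, field_char_0} \<Rightarrow> 'a::ab_group_add \<Rightarrow> 'a"
    and Basis :: "'a set"
    and mul :: "'a \<Rightarrow> 'a \<Rightarrow> 'a"
    and \<mu> :: "nat \<Rightarrow> 'a \<Rightarrow> 'a \<Rightarrow> 'a"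
    and hmul :: "'a fps \<Rightarrow> 'a fps \<Rightarrow> 'a fps"
  assumes "finite_dimensional_vector_space scale Basis"
    and "comm_assoc_algebra scale mul"
    and "pre_lie_formal_deformation scale mul \<mu> hmul"
  shows "F_manifold_algebra scale mul (\<lambda>x y. \<mu> 1 x y - \<mu> 1 y x)"
  using assms(3) by (rule pre_lie_formal_deformation.F_manifold_algebra_commutator)

end
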